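(* Let $1<p<\infty$ and $0<\gamma<1$. If $X\supset K_1\supset K_2\supset\cdots$ are compact sets and $K=\bigcap_{i=1}^\infty K_i$, then $$\lim_{i\to\infty}\mathcal{C}_{\gamma,p}(K_i)=\mathcal{C}_{\gamma,p}(K).$$
   Context: Setting: $X=(X,d,\mu)$ is a locally compact metric space equipped with a Borel regular outer measure $\mu$ that is doubling, i.e. there is a constant $c_d\ge 1$ with $\mu(B(x,2r))\le c_d\,\mu(B(x,r))$ for every ball $B(x,r)=\{y\in X: d(y,x)<r\}$. Every open ball has positive and finite measure. Spheres have measure zero, $\mu(\{y\in X: d(x,y)=r\})=0$ for all $x\in X$, $r>0$, and points have measure zero, $\mu(\{x\})=0$ for all $x\in X$. For $0<\gamma<1$, the Riesz potential of order $\gamma$ of a measurable function $f$ is $$I_\gamma f(x)=\int_X \frac{f(y)}{\mu(B(x,d(x,y)))^{1-\gamma}}\,d\mu(y)$$ (the single point $y=x$ may be omitted from the domain of integration, since it is $\mu$-null). $L^p_+(X)$ denotes the set of non-negative functions in $L^p(X)=L^p(X,\mu)$. For $1<p<\infty$ and any $E\subset X$, the Riesz $(\gamma,p)$-capacity is $\mathcal{C}_{\gamma,p}(E)=\inf_{f\in\mathcal{A}(E)}\|f\|_{L^p(X)}^p$, where $\mathcal{A}(E)=\{f\in L^p_+(X): I_\gamma f\ge 1\text{ on }E\}$ and $\mathcal{C}_{\gamma,p}(E)=\infty$ if $\mathcal{A}(E)=\emptyset$. *)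

theory Defs
  imports "HOL-Analysis.Analysis"
begin

text \<open>
  The space \<open>X\<close> is the type \<open>'a :: metric_space\<close>. An outer measure is a set function defined on
  all subsets of \<open>X\<close>.
\<close>

text \<open>
  \<^const>\<open>lambda_system\<close> is the sigma-algebra of Caratheodory measurable sets. The library states
  countable subadditivity in \<^const>\<open>outer_measure_space\<close> for disjoint families; with monotonicity
  this gives it for arbitrary ones.
\<close>

definition borel_regular_outer_measure :: "('a::topological_space set \<Rightarrow> ennreal) \<Rightarrow> bool" where
  "borel_regular_outer_measure \<mu> \<longleftrightarrow>
     outer_measure_space UNIV \<mu> \<and>
     sets borel \<subseteq> lambda_system UNIV UNIV \<mu> \<and>
     (\<forall>A. \<exists>B\<in>sets borel. A \<subseteq> B \<and> \<mu> B = \<mu> A)"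

definition doubling :: "('a::metric_space set \<Rightarrow> ennreal) \<Rightarrow> bool" where
  "doubling \<mu> \<longleftrightarrow>
     (\<exists>c::real. c \<ge> 1 \<and> (\<forall>x r. r > 0 \<longrightarrow> \<mu> (ball x (2 * r)) \<le> ennreal c * \<mu> (ball x r)))"

definition caratheodory_measure :: "('a set \<Rightarrow> ennreal) \<Rightarrow> 'a measure" where
  "caratheodory_measure \<mu> = measure_of UNIV (lambda_system UNIV UNIV \<mu>) \<mu>"

text \<open>The construction \<^const>\<open>measure_of\<close> falls back to the zero measure on non-measures; this does
  not happen here.\<close>

lemma
  assumes "outer_measure_space UNIV \<mu>"
  shows space_caratheodory_measure: "space (caratheodory_measure \<mu>) = UNIV"
    and sets_caratheodory_measure: "sets (caratheodory_measure \<mu>) = lambda_system UNIV UNIV \<mu>"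
    and emeasure_caratheodory_measure:
      "A \<in> lambda_system UNIV UNIV \<mu> \<Longrightarrow> emeasure (caratheodory_measure \<mu>) A = \<mu> A"
proof -
  interpret sigma_algebra "UNIV :: 'a set" "UNIV :: 'a set set"
    using sigma_algebra_Pow[of "UNIV :: 'a set"] by simp
  have ms: "measure_space UNIV (lambda_system UNIV UNIV \<mu>) \<mu>"
    by (rule caratheodory_lemma[OF assms])
  then have sa: "sigma_algebra UNIV (lambda_system UNIV UNIV \<mu>)"
    by (simp add: measure_space_def)
  show "space (caratheodory_measure \<mu>) = UNIV"
    by (simp add: caratheodory_measure_def space_measure_of_conv)
  show *: "sets (caratheodory_measure \<mu>) = lambda_system UNIV UNIV \<mu>"
    by (simp add: caratheodory_measure_def sigma_algebra.sets_measure_of_eq[OF sa])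
  show "emeasure (caratheodory_measure \<mu>) A = \<mu> A" if "A \<in> lambda_system UNIV UNIV \<mu>"
    using ms that * unfolding caratheodory_measure_def measure_space_def
    by (intro emeasure_measure_of_sigma) auto
qed

text \<open>
  The potential is only used for non-negative \<open>f\<close> (\<^const>\<open>ennreal\<close> truncates negative values) and
  may be infinite. The point \<open>y = x\<close>, where the kernel would have denominator zero, is omitted
  from the domain of integration. Balls have finite measure in the setting considered, so
  \<^const>\<open>enn2real\<close> loses nothing.
\<close>

definition riesz_potential ::
    "('a::metric_space set \<Rightarrow> ennreal) \<Rightarrow> real \<Rightarrow> ('a \<Rightarrow> real) \<Rightarrow> 'a \<Rightarrow> ennreal" where
  "riesz_potential \<mu> \<gamma> f x =
     (\<integral>\<^sup>+ y \<in> - {x}. ennreal (f y / enn2real (\<mu> (ball x (dist x y))) powr (1 - \<gamma>))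
        \<partial>caratheodory_measure \<mu>)"

definition Lp_norm :: "('a set \<Rightarrow> ennreal) \<Rightarrow> real \<Rightarrow> ('a \<Rightarrow> real) \<Rightarrow> real" where
  "Lp_norm \<mu> p f = (\<integral> x. \<bar>f x\<bar> powr p \<partial>caratheodory_measure \<mu>) powr (1 / p)"

definition Lp_plus :: "('a set \<Rightarrow> ennreal) \<Rightarrow> real \<Rightarrow> ('a \<Rightarrow> real) set" where
  "Lp_plus \<mu> p =
     {f \<in> borel_measurable (caratheodory_measure \<mu>).
        (\<forall>x. 0 \<le> f x) \<and> integrable (caratheodory_measure \<mu>) (\<lambda>x. \<bar>f x\<bar> powr p)}"

definition admissible ::
    "('a::metric_space set \<Rightarrow> ennreal) \<Rightarrow> real \<Rightarrow> real \<Rightarrow> 'a set \<Rightarrow> ('a \<Rightarrow> real) set" where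
  "admissible \<mu> \<gamma> p E = {f \<in> Lp_plus \<mu> p. \<forall>x\<in>E. 1 \<le> riesz_potential \<mu> \<gamma> f x}"

text \<open>The infimum over the empty set is \<open>\<infinity>\<close> in \<^typ>\<open>ennreal\<close>.\<close>

definition riesz_capacity ::
    "('a::metric_space set \<Rightarrow> ennreal) \<Rightarrow> real \<Rightarrow> real \<Rightarrow> 'a set \<Rightarrow> ennreal" where
  "riesz_capacity \<mu> \<gamma> p E = (INF f \<in> admissible \<mu> \<gamma> p E. ennreal (Lp_norm \<mu> p f powr p))"

end

theory Submission
  imports Defs
begin

text \<open>
  Along a decreasing sequence of sets the capacities decrease and stay above the capacity of the
  intersection, so the point is that a function \<open>f\<close> admissible for \<open>K = (\<Inter>i. K i)\<close> is almost
  admissible for some \<open>K i\<close>. This follows from lower semicontinuity of the potential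
  (\<open>open_riesz_superlevel\<close>): for \<open>c > 1\<close> the set where the potential of \<open>c f\<close> exceeds \<open>1\<close> is an
  open neighbourhood of \<open>K\<close>, and hence contains some \<open>K i\<close> by compactness. So \<open>c f\<close> is admissible
  for \<open>K i\<close>, at the cost of a factor \<open>c powr p\<close> in the energy, and \<open>c\<close> may tend to \<open>1\<close>.

  Lower semicontinuity comes from Fatou's lemma, once the kernel
  \<open>\<mu> (ball x (dist x y)) powr (\<gamma> - 1)\<close> is known to be continuous in \<open>x\<close> away from \<open>y\<close>. This is where
  the spheres being null sets enters: if \<open>u\<close> tends to \<open>x\<close> and \<open>r\<close> to \<open>s > 0\<close>, the indicator
  functions of the balls \<open>ball u r\<close> converge to that of \<open>ball x s\<close> off the sphere of radius \<open>s\<close>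
  about \<open>x\<close>, and so do the measures (\<open>tendsto_measure_ball\<close>).
\<close>

section \<open>Measures with null spheres\<close>

locale null_sphere_measure =
  fixes \<mu> :: "'a::metric_space set \<Rightarrow> ennreal"
  assumes outer_measure: "outer_measure_space UNIV \<mu>"
    and borel_subset: "sets borel \<subseteq> lambda_system UNIV UNIV \<mu>"
    and ball_pos: "r > 0 \<Longrightarrow> 0 < \<mu> (ball x r)"
    and ball_finite: "r > 0 \<Longrightarrow> \<mu> (ball x r) < \<infinity>"
    and sphere_null: "r > 0 \<Longrightarrow> \<mu> {y. dist x y = r} = 0"
begin

abbreviation M :: "'a measure" where
  "M \<equiv> caratheodory_measure \<mu>"

lemma borel_in_sets: "A \<in> sets borel \<Longrightarrow> A \<in> sets M"
  using borel_subset sets_caratheodory_measure[OF outer_measure] by blast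

lemma emeasure_borel: "A \<in> sets borel \<Longrightarrow> emeasure M A = \<mu> A"
  using borel_subset emeasure_caratheodory_measure[OF outer_measure] by blast

lemma borel_measurable_M:
  fixes g :: "'a \<Rightarrow> 'b::topological_space"
  assumes "g \<in> borel_measurable borel"
  shows "g \<in> borel_measurable M"
proof (rule measurableI)
  fix A :: "'b set" assume "A \<in> sets borel"
  with assms have "g -` A \<inter> space borel \<in> sets borel" by (rule measurable_sets)
  then show "g -` A \<inter> space M \<in> sets M"
    using borel_in_sets by (simp add: space_caratheodory_measure[OF outer_measure])
qed auto

lemma enn2real_ball: "enn2real (\<mu> (ball x r)) = measure M (ball x r)"
  by (simp add: measure_def emeasure_borel)

lemma fmeasurable_ball: "ball x r \<in> fmeasurable M"
proof (cases "r > 0")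
  case True
  then show ?thesis
    using ball_finite[of r x] by (intro fmeasurableI borel_in_sets) (auto simp: emeasure_borel)
next
  case False
  then show ?thesis by (simp add: ball_empty)
qed

lemma measure_ball_pos: "r > 0 \<Longrightarrow> 0 < measure M (ball x r)"
  using ball_pos[of r x] ball_finite[of r x]
  by (simp add: enn2real_ball[symmetric] enn2real_positive_iff)

text \<open>
  Dominated convergence for the indicator functions. As the centres and radii converge, all the
  balls lie in one large ball about \<open>x\<close>, whose indicator function is an integrable majorant.
\<close>

lemma tendsto_measure_ball:
  assumes u: "u \<longlonglongrightarrow> x" and r: "r \<longlonglongrightarrow> s" and s: "s > 0"
  shows "(\<lambda>n. measure M (ball (u n) (r n))) \<longlonglongrightarrow> measure M (ball x s)"
proof -
  have "(\<lambda>n. dist x (u n) + r n) \<longlonglongrightarrow> dist x x + s"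
    by (intro tendsto_intros u r)
  then have "Bseq (\<lambda>n. dist x (u n) + r n)"
    by (rule convergent_imp_Bseq[OF convergentI])
  then obtain R where R: "\<And>n. norm (dist x (u n) + r n) \<le> R"
    by (auto simp: Bseq_def)
  have sub: "ball (u n) (r n) \<subseteq> ball x (R + 1)" for n
  proof
    fix y assume "y \<in> ball (u n) (r n)"
    moreover have "dist x y \<le> dist x (u n) + dist (u n) y" by (rule dist_triangle)
    ultimately show "y \<in> ball x (R + 1)" using R[of n] by simp
  qed
  have sphere: "{y. dist x y = s} \<in> null_sets M"
  proof -
    have "closed {y. dist x y = s}"
      by (intro closed_Collect_eq continuous_intros)
    then show ?thesis
      using sphere_null[OF s] by (intro null_setsI borel_in_sets) (auto simp: emeasure_borel)
  qed
  have conv: "(\<lambda>n. indicator (ball (u n) (r n)) y :: real) \<longlonglongrightarrow> indicator (ball x s) y"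
    if "dist x y \<noteq> s" for y
  proof -
    have *: "(\<lambda>n. dist (u n) y - r n) \<longlonglongrightarrow> dist x y - s"
      by (intro tendsto_intros u r)
    have "\<forall>\<^sub>F n in sequentially.
        (indicator (ball (u n) (r n)) y :: real) = indicator (ball x s) y"
    proof (cases "dist x y < s")
      case True
      then have "\<forall>\<^sub>F n in sequentially. dist (u n) y - r n < 0"
        by (intro order_tendstoD(2)[OF *]) simp
      then show ?thesis by eventually_elim (use True in simp)
    next
      case False
      with that have "\<forall>\<^sub>F n in sequentially. dist (u n) y - r n > 0"
        by (intro order_tendstoD(1)[OF *]) simp
      then show ?thesis by eventually_elim (use False in simp)
    qed
    then show ?thesis by (rule tendsto_eventually)
  qed
  have "(\<lambda>n. \<integral>y. (indicator (ball (u n) (r n)) y :: real) \<partial>M)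
      \<longlonglongrightarrow> (\<integral>y. indicator (ball x s) y \<partial>M)"
  proof (rule integral_dominated_convergence[where w = "indicator (ball x (R + 1))"])
    show "integrable M (indicator (ball x (R + 1)) :: 'a \<Rightarrow> real)"
      using fmeasurable_ball by (simp add: fmeasurable_def)
    show "AE y in M. (\<lambda>n. indicator (ball (u n) (r n)) y :: real) \<longlonglongrightarrow> indicator (ball x s) y"
      by (rule AE_I'[OF sphere]) (use conv in auto)
    show "AE y in M. norm (indicator (ball (u n) (r n)) y :: real) \<le> indicator (ball x (R + 1)) y"
      for n
      using sub[of n] by (intro AE_I2) (auto simp: indicator_def)
  qed (auto intro!: borel_measurable_indicator borel_in_sets)
  then show ?thesis by (simp add: space_caratheodory_measure[OF outer_measure])
qed

section \<open>Lower semicontinuity of the potential\<close>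

text \<open>For fixed \<open>x\<close> the measure of \<open>ball x r\<close> is monotone in \<open>r\<close>, so it is a Borel function of \<open>r\<close>.\<close>

lemma borel_measurable_riesz_integrand:
  assumes f: "f \<in> borel_measurable M"
  shows "(\<lambda>y. ennreal (f y / enn2real (\<mu> (ball x (dist x y))) powr (1 - \<gamma>)) * indicator (- {x}) y)
    \<in> borel_measurable M"
proof -
  have "mono (\<lambda>r. measure M (ball x r))"
    by (intro monoI measure_mono_fmeasurable subset_ball fmeasurable_ball borel_in_sets) auto
  then have "(\<lambda>r. measure M (ball x r)) \<in> borel_measurable borel"
    by (rule borel_measurable_mono)
  then have "(\<lambda>y. measure M (ball x (dist x y))) \<in> borel_measurable borel"
    by (rule measurable_compose[rotated])
      (intro borel_measurable_continuous_onI continuous_intros)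
  note [measurable] = borel_measurable_M[OF this] f
  have [measurable]: "- {x} \<in> sets M"
    by (rule borel_in_sets) auto
  show ?thesis unfolding enn2real_ball by measurable
qed

text \<open>
  Fatou's lemma for the integrands at the points \<open>u n\<close>. They converge to the integrand at \<open>x\<close> in
  every \<open>y \<noteq> x\<close>. In \<open>y = x\<close>, where the kernel is singular and may fail to converge, the limit
  integrand vanishes because that point is left out of the integral, so the lower bound that
  Fatou's lemma asks for is trivial there.
\<close>

lemma riesz_potential_le_liminf:
  assumes f: "f \<in> borel_measurable M" and u: "u \<longlonglongrightarrow> x"
  shows "riesz_potential \<mu> \<gamma> f x \<le> liminf (\<lambda>n. riesz_potential \<mu> \<gamma> f (u n))"
proof -
  define g where "g = (\<lambda>z y. ennreal (f y / enn2real (\<mu> (ball z (dist z y))) powr (1 - \<gamma>))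
      * indicator (- {z}) y)"
  have pot: "riesz_potential \<mu> \<gamma> f z = (\<integral>\<^sup>+ y. g z y \<partial>M)" for z
    by (simp add: riesz_potential_def g_def)
  have "g x y \<le> liminf (\<lambda>n. g (u n) y)" for y
  proof (cases "y = x")
    case True
    then show ?thesis by (simp add: g_def)
  next
    case False
    then have d: "dist x y > 0" by simp
    have "(\<lambda>n. measure M (ball (u n) (dist (u n) y))) \<longlonglongrightarrow> measure M (ball x (dist x y))"
      by (intro tendsto_measure_ball d u tendsto_intros)
    then have lim: "(\<lambda>n. ennreal (f y / measure M (ball (u n) (dist (u n) y)) powr (1 - \<gamma>)))
        \<longlonglongrightarrow> ennreal (f y / measure M (ball x (dist x y)) powr (1 - \<gamma>))"
      using measure_ball_pos[OF d, of x] by (intro tendsto_intros) auto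
    have "\<forall>\<^sub>F n in sequentially. u n \<noteq> y"
      using u False by (rule tendsto_imp_eventually_ne[OF _ not_sym])
    then have "\<forall>\<^sub>F n in sequentially.
        ennreal (f y / measure M (ball (u n) (dist (u n) y)) powr (1 - \<gamma>)) = g (u n) y"
      by eventually_elim (auto simp: g_def enn2real_ball)
    from Lim_transform_eventually[OF lim this] False have "(\<lambda>n. g (u n) y) \<longlonglongrightarrow> g x y"
      by (simp add: g_def enn2real_ball)
    then show ?thesis by (simp add: lim_imp_Liminf)
  qed
  then have "(\<integral>\<^sup>+ y. g x y \<partial>M) \<le> (\<integral>\<^sup>+ y. liminf (\<lambda>n. g (u n) y) \<partial>M)"
    by (intro nn_integral_mono)
  also have "\<dots> \<le> liminf (\<lambda>n. \<integral>\<^sup>+ y. g (u n) y \<partial>M)"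
    by (intro nn_integral_liminf) (auto simp: g_def intro!: borel_measurable_riesz_integrand f)
  finally show ?thesis by (simp add: pot)
qed

lemma open_riesz_superlevel:
  assumes f: "f \<in> borel_measurable M"
  shows "open {x. a < riesz_potential \<mu> \<gamma> f x}"
proof -
  have "closed {x. riesz_potential \<mu> \<gamma> f x \<le> a}"
    unfolding closed_sequential_limits
  proof (intro allI impI)
    fix u x assume *: "(\<forall>n. u n \<in> {x. riesz_potential \<mu> \<gamma> f x \<le> a}) \<and> u \<longlonglongrightarrow> x"
    then have "riesz_potential \<mu> \<gamma> f x \<le> liminf (\<lambda>n. riesz_potential \<mu> \<gamma> f (u n))"
      by (intro riesz_potential_le_liminf f) simp
    also have "\<dots> \<le> liminf (\<lambda>n::nat. a)"
      using * by (intro Liminf_mono) auto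
    finally show "x \<in> {x. riesz_potential \<mu> \<gamma> f x \<le> a}"
      by (simp add: Liminf_const)
  qed
  then show ?thesis
    by (simp add: closed_def Compl_eq not_le)
qed

lemma riesz_potential_cmult:
  assumes "f \<in> borel_measurable M" and "0 \<le> c"
  shows "riesz_potential \<mu> \<gamma> (\<lambda>y. c * f y) x = ennreal c * riesz_potential \<mu> \<gamma> f x"
proof -
  have "riesz_potential \<mu> \<gamma> (\<lambda>y. c * f y) x =
    (\<integral>\<^sup>+ y. ennreal c * (ennreal (f y / enn2real (\<mu> (ball x (dist x y))) powr (1 - \<gamma>))
        * indicator (- {x}) y) \<partial>M)"
    unfolding riesz_potential_def
    by (simp add: ennreal_mult'[OF assms(2)] mult.assoc flip: times_divide_eq_right)
  then show ?thesis
    unfolding riesz_potential_def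
    by (simp only: nn_integral_cmult[OF borel_measurable_riesz_integrand[OF assms(1)]])
qed

end

section \<open>Capacity of decreasing compact sets\<close>

lemma Lp_norm_powr:
  assumes "p > 0"
  shows "Lp_norm \<mu> p f powr p = (\<integral>x. \<bar>f x\<bar> powr p \<partial>caratheodory_measure \<mu>)"
  using assms by (simp add: Lp_norm_def powr_powr)

lemma Lp_norm_powr_cmult:
  assumes "p > 0" "0 \<le> c"
  shows "Lp_norm \<mu> p (\<lambda>x. c * f x) powr p = c powr p * Lp_norm \<mu> p f powr p"
  using assms by (simp add: Lp_norm_powr abs_mult powr_mult)

lemma Lp_plus_cmult:
  assumes "f \<in> Lp_plus \<mu> p" "0 \<le> c"
  shows "(\<lambda>x. c * f x) \<in> Lp_plus \<mu> p"
  using assms by (auto simp: Lp_plus_def abs_mult powr_mult)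

lemma riesz_capacity_mono:
  "A \<subseteq> B \<Longrightarrow> riesz_capacity \<mu> \<gamma> p A \<le> riesz_capacity \<mu> \<gamma> p B"
  unfolding riesz_capacity_def by (rule INF_superset_mono) (auto simp: admissible_def)

text \<open>Together with \<open>U\<close>, the complements of the \<open>K i\<close> form an open cover of \<open>K 0\<close>.\<close>

lemma decreasing_compact_subset_open:
  fixes K :: "nat \<Rightarrow> 'a::t2_space set"
  assumes compact: "\<And>i. compact (K i)" and dec: "\<And>i. K (Suc i) \<subseteq> K i"
    and "open U" and sub: "(\<Inter>i. K i) \<subseteq> U"
  obtains i where "K i \<subseteq> U"
proof -
  have K_mono: "K n \<subseteq> K m" if "m \<le> n" for m n
    using lift_Suc_antimono_le[of K, OF dec that] .
  have cover: "K 0 \<subseteq> (\<Union>i. U \<union> - K i)" using sub by auto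
  have open_cover: "open (U \<union> - K i)" for i
    using compact_imp_closed[OF compact] \<open>open U\<close> by auto
  obtain I where I: "finite I" "K 0 \<subseteq> (\<Union>i\<in>I. U \<union> - K i)"
    by (rule compactE_image[of "K 0" UNIV "\<lambda>i. U \<union> - K i", OF compact open_cover cover])
  from I(1) obtain m where m: "\<forall>i\<in>I. i \<le> m"
    by (auto simp: finite_nat_set_iff_bounded_le)
  have "K m \<subseteq> U"
  proof
    fix x assume x: "x \<in> K m"
    then have "x \<in> K 0" using K_mono[of 0 m] by auto
    with I(2) obtain i where "i \<in> I" "x \<in> U \<union> - K i" by blast
    moreover have "x \<in> K i" using K_mono[of i m] m \<open>i \<in> I\<close> x by auto
    ultimately show "x \<in> U" by auto
  qed
  then show thesis by (rule that)
qed

context null_sphere_measure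
begin

text \<open>
  Admissibility only gives a potential of at least \<open>1\<close> on the intersection, while superlevel sets
  are open for a strict inequality. Multiplying by \<open>c > 1\<close> makes the inequality strict.
\<close>

lemma riesz_capacity_enlarge:
  fixes K :: "nat \<Rightarrow> 'a set"
  assumes compact: "\<And>i. compact (K i)" and dec: "\<And>i. K (Suc i) \<subseteq> K i"
    and f: "f \<in> admissible \<mu> \<gamma> p (\<Inter>i. K i)" and c: "c > 1" and p: "p > 0"
  obtains i where "riesz_capacity \<mu> \<gamma> p (K i) \<le> ennreal (c powr p * Lp_norm \<mu> p f powr p)"
proof -
  have Lp: "f \<in> Lp_plus \<mu> p" and f_meas: "f \<in> borel_measurable M"
    using f by (auto simp: admissible_def Lp_plus_def)
  define h where "h = (\<lambda>y. c * f y)"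
  have h: "h \<in> Lp_plus \<mu> p" using Lp c by (simp add: h_def Lp_plus_cmult)
  then have "open {x. 1 < riesz_potential \<mu> \<gamma> h x}"
    by (intro open_riesz_superlevel) (simp add: Lp_plus_def)
  moreover have "(\<Inter>i. K i) \<subseteq> {x. 1 < riesz_potential \<mu> \<gamma> h x}"
  proof
    fix x assume "x \<in> (\<Inter>i. K i)"
    then have "1 \<le> riesz_potential \<mu> \<gamma> f x" using f by (auto simp: admissible_def)
    then have "ennreal c * 1 \<le> ennreal c * riesz_potential \<mu> \<gamma> f x" by (rule mult_left_mono) simp
    then have "ennreal c \<le> riesz_potential \<mu> \<gamma> h x"
      using c by (simp add: h_def riesz_potential_cmult[OF f_meas])
    moreover have "1 < ennreal c" using c by simp
    ultimately show "x \<in> {x. 1 < riesz_potential \<mu> \<gamma> h x}"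
      by (auto intro: less_le_trans simp del: one_less_ennreal)
  qed
  ultimately obtain i where "K i \<subseteq> {x. 1 < riesz_potential \<mu> \<gamma> h x}"
    by (rule decreasing_compact_subset_open[of K, OF compact dec])
  with h have "h \<in> admissible \<mu> \<gamma> p (K i)"
    by (auto simp: admissible_def intro: less_imp_le)
  then have "riesz_capacity \<mu> \<gamma> p (K i) \<le> ennreal (Lp_norm \<mu> p h powr p)"
    unfolding riesz_capacity_def by (rule INF_lower)
  also have "Lp_norm \<mu> p h powr p = c powr p * Lp_norm \<mu> p f powr p"
    using p c by (simp add: h_def Lp_norm_powr_cmult)
  finally show thesis by (rule that)
qed

theorem riesz_capacity_decreasing_compact:
  fixes K :: "nat \<Rightarrow> 'a set"
  assumes compact: "\<And>i. compact (K i)" and dec: "\<And>i. K (Suc i) \<subseteq> K i" and p: "p > 0"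
  shows "(\<lambda>i. riesz_capacity \<mu> \<gamma> p (K i)) \<longlonglongrightarrow> riesz_capacity \<mu> \<gamma> p (\<Inter>i. K i)"
proof -
  let ?C = "riesz_capacity \<mu> \<gamma> p"
  have "(INF i. ?C (K i)) \<le> ennreal (Lp_norm \<mu> p f powr p)"
    if f: "f \<in> admissible \<mu> \<gamma> p (\<Inter>i. K i)" for f
  proof (rule tendsto_lowerbound)
    have "((\<lambda>c. ennreal (c powr p * Lp_norm \<mu> p f powr p))
        \<longlongrightarrow> ennreal (1 powr p * Lp_norm \<mu> p f powr p)) (at_right 1)"
      by (intro tendsto_intros) auto
    then show "((\<lambda>c. ennreal (c powr p * Lp_norm \<mu> p f powr p))
        \<longlongrightarrow> ennreal (Lp_norm \<mu> p f powr p)) (at_right 1)"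
      by simp
    have "(INF i. ?C (K i)) \<le> ennreal (c powr p * Lp_norm \<mu> p f powr p)" if "c > 1" for c
      using riesz_capacity_enlarge[OF compact dec f that p] by (metis INF_lower2 UNIV_I)
    then show "\<forall>\<^sub>F c in at_right 1. (INF i. ?C (K i)) \<le> ennreal (c powr p * Lp_norm \<mu> p f powr p)"
      by (auto simp: eventually_at_right_less eventually_at_filter)
  qed simp
  then have "(INF i. ?C (K i)) \<le> ?C (\<Inter>i. K i)"
    unfolding riesz_capacity_def[of _ _ _ "\<Inter>i. K i"] by (intro INF_greatest)
  moreover have "?C (\<Inter>i. K i) \<le> (INF i. ?C (K i))"
    by (intro INF_greatest riesz_capacity_mono) auto
  ultimately have "(INF i. ?C (K i)) = ?C (\<Inter>i. K i)" by (rule antisym)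
  moreover have "decseq (\<lambda>i. ?C (K i))"
    using dec by (intro decseq_SucI riesz_capacity_mono)
  ultimately show ?thesis using LIMSEQ_INF by metis
qed

end

theorem theorem3p11:
  fixes \<mu> :: "'a::metric_space set \<Rightarrow> ennreal"
    and \<gamma> p :: real
    and K :: "nat \<Rightarrow> 'a set"
  assumes "locally_compact_space (euclidean :: 'a topology)"
    and "borel_regular_outer_measure \<mu>"
    and "doubling \<mu>"
    and "\<And>x r. r > 0 \<Longrightarrow> 0 < \<mu> (ball x r) \<and> \<mu> (ball x r) < \<infinity>"
    and "\<And>x r. r > 0 \<Longrightarrow> \<mu> {y. dist x y = r} = 0"
    and "\<And>x. \<mu> {x} = 0"
    and "1 < p"
    and "0 < \<gamma>" and "\<gamma> < 1"
    and "\<And>i. compact (K i)"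
    and "\<And>i. K (Suc i) \<subseteq> K i"
  shows "(\<lambda>i. riesz_capacity \<mu> \<gamma> p (K i)) \<longlonglongrightarrow> riesz_capacity \<mu> \<gamma> p (\<Inter>i. K i)"
proof -
  interpret null_sphere_measure \<mu>
    using assms(2,4,5) by unfold_locales (auto simp: borel_regular_outer_measure_def)
  show ?thesis
    using assms(7,10,11) by (intro riesz_capacity_decreasing_compact) auto
qed

end
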